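(* Let $k\ge 2$ be an integer, and let $\mathbb{F}$ be a field such that $p(\mathbb{F}) > 6k - 6$ and $p(\mathbb{F}) \neq 8k - 7$. Let $A$ be a subset of $\mathbb{F}$ with $k$ elements such that $A \cap (- A) = \varnothing$. Then $$|3_{\pm}A| \geq 6k - 5.$$
   Context: For a field $\mathbb{F}$, $p(\mathbb{F})$ denotes the order of the smallest nontrivial subgroup of the additive group of $\mathbb{F}$, or $\infty$ if there is no such finite subgroup; equivalently, the characteristic of $\mathbb{F}$ if it is positive and $\infty$ if the characteristic is $0$. For a finite set $A=\{a_1,\dots,a_k\}$ with $|A|=k$, write $-A=\{-a:a\in A\}$ and $3_{\pm}A=\{\sum_{i=1}^k\lambda_i a_i:\lambda_i\in\mathbb{Z}\cap[-3,3],\ \sum_{i=1}^k|\lambda_i|=3\}$. *)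

theory Defs
  imports Main "HOL-Library.Extended_Nat"
begin

definition additive_subgroup :: "'a::ab_group_add set \<Rightarrow> bool" where
  "additive_subgroup H \<longleftrightarrow>
     0 \<in> H \<and> (\<forall>x\<in>H. \<forall>y\<in>H. x + y \<in> H) \<and> (\<forall>x\<in>H. - x \<in> H)"

(* p(G), the order of the smallest nontrivial finite subgroup of the additive group of 'a.
   The infimum of the empty set in enat is \<infinity>, the value taken when there is no
   such subgroup.  The subgroup may be all of 'a. *)
definition smallest_subgroup_order :: "'a::ab_group_add itself \<Rightarrow> enat" where
  "smallest_subgroup_order _ =
     Inf {enat (card H) | H :: 'a set. additive_subgroup H \<and> finite H \<and> H \<noteq> {0}}"

(* h_\<plusminus>A for a finite set A; the coefficients are indexed by the elements of A themselves,
   and the values of l outside A play no role. *)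
definition signed_sumset :: "nat \<Rightarrow> 'a::ring_1 set \<Rightarrow> 'a set" where
  "signed_sumset h A =
     {\<Sum>a\<in>A. of_int (l a) * a | l :: 'a \<Rightarrow> int.
        (\<forall>a\<in>A. l a \<in> {- int h..int h}) \<and> (\<Sum>a\<in>A. \<bar>l a\<bar>) = int h}"

end

theory Submission
  imports Defs "HOL-Computational_Algebra.Polynomial" "HOL-Library.FuncSet"
begin

text \<open>
  Put \<open>S = A \<union> -A\<close>, a set of \<open>2k\<close> elements.  A sum \<open>x + y + z\<close> of three elements of \<open>S\<close> lies in the
  signed sumset as soon as no two of the summands are opposite
  (\<open>nonopposite_triple_sum_in_signed_sumset\<close>), so it suffices to count such sums
  (\<open>card_nonopposite_triple_sums\<close>).  That is a restricted-sumset problem, and the polynomial method of Alon, Nathanson and Ruzsa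
  applies: if there were at most \<open>m = 6k - 6\<close> such sums, one could choose a monic \<open>P\<close> of degree
  \<open>m\<close> in one variable that vanishes at all of them, and then
  \<open>(x + y) * (y + z) * (x + z) * P (x + y + z)\<close> would vanish on \<open>S \<times> S \<times> S\<close>.

  The total degree of this polynomial is \<open>3n\<close> with \<open>n = 2k - 1 = card S - 1\<close>, so by the
  Combinatorial Nullstellensatz its coefficient at \<open>x^n y^n z^n\<close> has to be \<open>0\<close>.  Only the top
  power of \<open>P\<close> contributes to that coefficient, which is therefore
  \<open>6 * m! / ((n-2)! (n-1)! n!) + 2 * m! / ((n-1)!)^3 = (8n - 6) * m! / ((n-1)!^2 n!)\<close>, where
  \<open>8n - 6 = 2 * (8k - 7)\<close>.

  Let \<open>p\<close> be the smallest subgroup order; if it is finite, it is the characteristic of the field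
  (\<open>smallest_subgroup_order_eq_CHAR\<close>).  The assumption \<open>p > 6k - 6\<close> keeps \<open>m!\<close> and \<open>2\<close> invertible.  It also leaves \<open>p = 8k - 7\<close> as the
  only way for \<open>p\<close> to divide \<open>8k - 7\<close>, because \<open>2p > 8k - 7\<close>.  This is where the excluded value
  of \<open>p\<close> comes from.

  The Nullstellensatz enters through a linear functional rather than through polynomials in
  three variables.  The set \<open>S\<close> carries weights \<open>w\<close> that annihilate the powers below \<open>n\<close> and
  send the power \<open>n\<close> to \<open>1\<close> (\<open>top_coefficient_weights\<close>).  Summing with the weights
  \<open>w x * w y * w z\<close> over \<open>S \<times> S \<times> S\<close> then reads off the coefficient at \<open>x^n y^n z^n\<close> of every
  polynomial of total degree at most \<open>3n\<close>.  The values needed are \<open>weighted_moment_below\<close> and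
  \<open>weighted_moment_top\<close>.
\<close>

section \<open>The smallest subgroup order and the characteristic\<close>

text \<open>Every subgroup that contains \<open>x\<close> contains these multiples, so a nontrivial finite subgroup
  has at least \<open>CHAR('a)\<close> elements.  For \<open>x = 1\<close> in positive characteristic the multiples form a
  subgroup that attains this bound.\<close>

lemma card_multiples_eq_CHAR:
  fixes x :: "'a::field"
  assumes "x \<noteq> 0"
  shows "card ((\<lambda>i. of_nat i * x) ` {..<CHAR('a)}) = CHAR('a)"
proof -
  have "inj_on (\<lambda>i. of_nat i * x) {..<CHAR('a)}"
  proof (rule linorder_inj_onI)
    fix i j :: nat
    assume "i < j" "i \<in> {..<CHAR('a)}" "j \<in> {..<CHAR('a)}"
    then have "\<not> CHAR('a) dvd (j - i)"
      by (auto dest: dvd_imp_le)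
    then have "of_nat (j - i) \<noteq> (0::'a)"
      by (simp add: of_nat_eq_0_iff_char_dvd)
    with \<open>i < j\<close> have "of_nat i \<noteq> (of_nat j :: 'a)"
      by (simp add: of_nat_diff)
    with assms show "of_nat i * x \<noteq> of_nat j * x" by simp
  qed auto
  then show ?thesis by (simp add: card_image)
qed

lemma smallest_subgroup_order_eq_CHAR:
  assumes "CHAR('a::field) > 0"
  shows "smallest_subgroup_order TYPE('a) = enat CHAR('a)"
proof -
  let ?p = "CHAR('a)"
  let ?P = "(\<lambda>i. of_nat i * (1::'a)) ` {..<?p}"
  have mod: "of_nat i \<in> ?P" for i
  proof -
    have "of_nat i = (of_nat (i mod ?p) :: 'a)"
      by (metis mult_div_mod_eq add_0 mult_zero_left of_nat_CHAR of_nat_add of_nat_mult)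
    then show ?thesis using assms by force
  qed
  have "additive_subgroup ?P"
    unfolding additive_subgroup_def
  proof (intro conjI ballI)
    show "0 \<in> ?P" using mod[of 0] by simp
  next
    fix x y assume "x \<in> ?P" "y \<in> ?P"
    then obtain i j where "x = of_nat i" "y = of_nat j" by auto
    then show "x + y \<in> ?P" using mod[of "i + j"] by simp
  next
    fix x assume "x \<in> ?P"
    then obtain i where i: "x = of_nat i" "i < ?p" by auto
    then have "- x = of_nat (?p - i)" by (simp add: of_nat_diff)
    then show "- x \<in> ?P" using mod by simp
  qed
  moreover have card: "card ?P = ?p"
    by (rule card_multiples_eq_CHAR) simp
  moreover have "?P \<noteq> {0}"
    using mod[of 1] by (metis of_nat_1 singletonD zero_neq_one)
  ultimately have le: "smallest_subgroup_order TYPE('a) \<le> enat ?p"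
    unfolding smallest_subgroup_order_def
    by (intro Inf_lower CollectI exI[of _ ?P]) auto
  have "?p \<le> card H" if H: "additive_subgroup H" "finite H" "H \<noteq> {0}" for H :: "'a set"
  proof -
    from H obtain x where x: "x \<in> H" "x \<noteq> 0"
      unfolding additive_subgroup_def by blast
    have "of_nat i * x \<in> H" for i
    proof (induction i)
      case 0
      then show ?case using H(1) by (simp add: additive_subgroup_def)
    next
      case (Suc i)
      then show ?case using H(1) x(1) by (auto simp: additive_subgroup_def algebra_simps)
    qed
    then have "(\<lambda>i. of_nat i * x) ` {..<?p} \<subseteq> H" by auto
    with H(2) have "card ((\<lambda>i. of_nat i * x) ` {..<?p}) \<le> card H"
      by (rule card_mono)
    then show ?thesis using card_multiples_eq_CHAR[OF x(2)] by simp
  qed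
  then have "enat ?p \<le> smallest_subgroup_order TYPE('a)"
    unfolding smallest_subgroup_order_def
    by (intro Inf_greatest) (elim CollectE exE conjE, simp only: enat_ord_simps)
  with le show ?thesis by simp
qed

lemma of_nat_neq_0_if_less_smallest_subgroup_order:
  assumes "smallest_subgroup_order TYPE('a::field) > enat m" "0 < i" "i \<le> m"
  shows "of_nat i \<noteq> (0::'a)"
proof
  assume "of_nat i = (0::'a)"
  then have dvd: "CHAR('a) dvd i" by (simp add: of_nat_eq_0_iff_char_dvd)
  with \<open>0 < i\<close> have "CHAR('a) > 0" by (auto intro: gr0I)
  then have "CHAR('a) > m"
    using assms(1) smallest_subgroup_order_eq_CHAR[where 'a = 'a] by simp
  moreover have "CHAR('a) \<le> i" using dvd \<open>0 < i\<close> by (rule dvd_imp_le)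
  ultimately show False using \<open>i \<le> m\<close> by simp
qed

lemma of_nat_fact_neq_0:
  assumes "\<And>i. 0 < i \<Longrightarrow> i \<le> m \<Longrightarrow> of_nat i \<noteq> (0::'a::field)"
  shows "of_nat (fact m) \<noteq> (0::'a)"
  using assms
proof (induction m)
  case (Suc m)
  have "of_nat (fact m) \<noteq> (0::'a)" by (rule Suc.IH) (simp add: Suc.prems)
  moreover have "of_nat (Suc m) \<noteq> (0::'a)" using Suc.prems[of "Suc m"] by simp
  ultimately show ?case unfolding fact_Suc of_nat_mult by simp
qed simp

section \<open>Reading off a coefficient by weighted summation\<close>

text \<open>The weights are \<open>w s = 1 / (\<Prod>t\<in>S - {s}. s - t)\<close>.  Lagrange interpolation of the power
  \<open>X^j\<close> at the \<open>n + 1\<close> points of \<open>S\<close> reproduces it for \<open>j \<le> n\<close>, and comparing the coefficients at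
  \<open>X^n\<close> gives the identity.\<close>

lemma top_coefficient_weights:
  fixes S :: "'a::field set"
  assumes "finite S" "card S = Suc n"
  obtains w :: "'a \<Rightarrow> 'a" where
    "\<And>j. j \<le> n \<Longrightarrow> (\<Sum>s\<in>S. w s * s ^ j) = (if j = n then 1 else 0)"
proof -
  define w where "w s = inverse (\<Prod>t\<in>S - {s}. s - t)" for s
  define b where "b s = (\<Prod>t\<in>S - {s}. [:- t, 1:])" for s
  have deg_b: "degree (b s) = n" if "s \<in> S" for s
    using assms that by (simp add: b_def degree_prod_eq_sum_degree)
  have lead_b: "coeff (b s) n = 1" if "s \<in> S" for s
    using deg_b[OF that] lead_coeff_prod[of "\<lambda>t. [:- t, 1:]" "S - {s}"] by (simp add: b_def)
  have poly_b: "poly (b s) t = (if t = s then inverse (w s) else 0)" if "s \<in> S" "t \<in> S" for s t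
    using assms(1) that by (auto simp: b_def w_def poly_prod)
  have w_nz: "w s \<noteq> 0" for s
    using assms(1) by (auto simp: w_def)
  have "(\<Sum>s\<in>S. w s * s ^ j) = (if j = n then 1 else 0)" if "j \<le> n" for j
  proof -
    define I where "I = (\<Sum>s\<in>S. smult (w s * s ^ j) (b s))"
    have "I = monom 1 j"
    proof (rule poly_eqI_degree)
      fix t assume "t \<in> S"
      have "poly I t = (\<Sum>s\<in>S. if t = s then t ^ j else 0)"
        unfolding I_def poly_sum
        by (rule sum.cong) (auto simp: poly_b \<open>t \<in> S\<close> w_nz)
      then show "poly I t = poly (monom 1 j) t"
        using assms(1) \<open>t \<in> S\<close> by (simp add: poly_monom)
    next
      have "degree I \<le> n"
        unfolding I_def
        by (intro degree_sum_le assms) (auto intro: order.trans[OF degree_smult_le] simp: deg_b)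
      then show "card S > degree I" using assms by simp
    next
      show "card S > degree (monom (1::'a) j)" using assms that by (simp add: degree_monom_eq)
    qed
    then have "coeff I n = (if j = n then 1 else 0)" by simp
    moreover have "coeff I n = (\<Sum>s\<in>S. w s * s ^ j)"
      unfolding I_def coeff_sum by (rule sum.cong) (auto simp: lead_b)
    ultimately show ?thesis by simp
  qed
  with that show ?thesis by blast
qed

definition weighted_moment ::
  "('a::field \<Rightarrow> 'a) \<Rightarrow> 'a set \<Rightarrow> nat \<Rightarrow> nat \<Rightarrow> nat \<Rightarrow> nat \<Rightarrow> 'a" where
  "weighted_moment w S a b c j =
     (\<Sum>x\<in>S. \<Sum>y\<in>S. \<Sum>z\<in>S. w x * w y * w z * (x ^ a * y ^ b * z ^ c * (x + y + z) ^ j))"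

lemma weighted_moment_0:
  "weighted_moment w S a b c 0 =
     (\<Sum>x\<in>S. w x * x ^ a) * ((\<Sum>y\<in>S. w y * y ^ b) * (\<Sum>z\<in>S. w z * z ^ c))"
  unfolding weighted_moment_def
  unfolding sum_product
  unfolding sum_distrib_left
  by (intro sum.cong refl) (simp add: mult_ac)

lemma weighted_moment_Suc:
  "weighted_moment w S a b c (Suc j) =
     weighted_moment w S (Suc a) b c j + weighted_moment w S a (Suc b) c j
       + weighted_moment w S a b (Suc c) j"
  unfolding weighted_moment_def sum.distrib[symmetric]
  by (intro sum.cong refl) (simp add: algebra_simps)

lemma weighted_moment_below:
  fixes w :: "'a::field \<Rightarrow> 'a"
  assumes w: "\<And>j. j \<le> n \<Longrightarrow> (\<Sum>s\<in>S. w s * s ^ j) = (if j = n then 1 else 0)"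
  assumes "a + b + c + j \<le> 3 * n"
    and "a + b + c + j < 3 * n \<or> n < a \<or> n < b \<or> n < c"
  shows "weighted_moment w S a b c j = 0"
  using assms(2,3)
proof (induction j arbitrary: a b c)
  case 0
  \<comment> \<open>One of the exponents is below the average \<open>n\<close>.\<close>
  then have "a < n \<or> b < n \<or> c < n" by linarith
  then show ?case by (auto simp: weighted_moment_0 w)
next
  case (Suc j)
  have "weighted_moment w S (Suc a) b c j = 0" "weighted_moment w S a (Suc b) c j = 0"
    "weighted_moment w S a b (Suc c) j = 0"
    using Suc.prems by (auto intro!: Suc.IH)
  then show ?case by (simp add: weighted_moment_Suc)
qed

text \<open>The value is the multinomial coefficient \<open>j! / ((n - a)! (n - b)! (n - c)!)\<close>, stated without
  a division because the factorials may vanish in a field of positive characteristic.\<close>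

lemma weighted_moment_top:
  fixes w :: "'a::field \<Rightarrow> 'a"
  assumes w: "\<And>j. j \<le> n \<Longrightarrow> (\<Sum>s\<in>S. w s * s ^ j) = (if j = n then 1 else 0)"
  assumes "a + b + c + j = 3 * n" "a \<le> n" "b \<le> n" "c \<le> n"
  shows "of_nat (fact (n - a) * fact (n - b) * fact (n - c)) * weighted_moment w S a b c j =
    of_nat (fact j)"
  using assms(2-)
proof (induction j arbitrary: a b c)
  case 0
  then have "a = n" "b = n" "c = n" by linarith+
  then show ?case by (simp add: weighted_moment_0 w)
next
  case (Suc j)
  let ?F = "\<lambda>a b c. of_nat (fact (n - a) * fact (n - b) * fact (n - c)) :: 'a"
  have fact_step: "fact (n - d) = (n - d) * (fact (n - Suc d) :: nat)" if "d < n" for d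
    using fact_reduce[of "n - d", where 'a = nat] that by simp
  \<comment> \<open>Raising the exponent \<open>a\<close> by one costs a factor \<open>n - a\<close>.  An exponent above \<open>n\<close> makes the
    moment vanish, in accordance with this factor for \<open>a = n\<close>.\<close>
  have 1: "?F a b c * weighted_moment w S (Suc a) b c j = of_nat ((n - a) * fact j)"
  proof (cases "a = n")
    case True
    then show ?thesis using Suc.prems by (simp add: weighted_moment_below[OF w])
  next
    case False
    then have "?F (Suc a) b c * weighted_moment w S (Suc a) b c j = of_nat (fact j)"
      using Suc.prems by (intro Suc.IH) auto
    then show ?thesis
      using False Suc.prems by (simp add: fact_step mult.assoc del: of_nat_diff)
  qed
  have 2: "?F a b c * weighted_moment w S a (Suc b) c j = of_nat ((n - b) * fact j)"
  proof (cases "b = n")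
    case True
    then show ?thesis using Suc.prems by (simp add: weighted_moment_below[OF w])
  next
    case False
    then have "?F a (Suc b) c * weighted_moment w S a (Suc b) c j = of_nat (fact j)"
      using Suc.prems by (intro Suc.IH) auto
    then show ?thesis
      using False Suc.prems by (simp add: fact_step mult_ac del: of_nat_diff)
  qed
  have 3: "?F a b c * weighted_moment w S a b (Suc c) j = of_nat ((n - c) * fact j)"
  proof (cases "c = n")
    case True
    then show ?thesis using Suc.prems by (simp add: weighted_moment_below[OF w])
  next
    case False
    then have "?F a b (Suc c) * weighted_moment w S a b (Suc c) j = of_nat (fact j)"
      using Suc.prems by (intro Suc.IH) auto
    then show ?thesis
      using False Suc.prems by (simp add: fact_step mult_ac del: of_nat_diff)
  qed
  have "?F a b c * weighted_moment w S a b c (Suc j) =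
      of_nat ((n - a) * fact j + (n - b) * fact j + (n - c) * fact j)"
    unfolding weighted_moment_Suc distrib_left 1 2 3 of_nat_add ..
  also have "(n - a) * fact j + (n - b) * fact j + (n - c) * fact j
      = ((n - a) + (n - b) + (n - c)) * (fact j :: nat)"
    by (simp only: distrib_right)
  also have "(n - a) + (n - b) + (n - c) = Suc j" using Suc.prems by linarith
  also have "Suc j * fact j = (fact (Suc j) :: nat)" by simp
  finally show ?case .
qed

section \<open>Sums of three elements, no two of them opposite\<close>

text \<open>
  With \<open>m = 3n - 3\<close>, the functional given by the weights takes
  \<open>(x + y) * (y + z) * (x + z) * (x + y + z) ^ j\<close> to \<open>0\<close> for \<open>j < m\<close>.  For \<open>j = m\<close> its value,
  multiplied by \<open>(n-1)!^2 n!\<close>, is \<open>(6 * (n - 1) + 2 * n) * m!\<close>: the product of the three pair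
  sums consists of six monomials of type \<open>x^2 y\<close> and of \<open>2 x y z\<close>.
\<close>

lemma card_nonopposite_triple_sums:
  fixes S :: "'a::field set"
  assumes S: "finite S" "card S = Suc n" and "n \<ge> 2"
    and nz: "of_nat ((8 * n - 6) * fact (3 * n - 3)) \<noteq> (0::'a)"
  shows "card {x + y + z | x y z. x \<in> S \<and> y \<in> S \<and> z \<in> S \<and> x + y \<noteq> 0 \<and> y + z \<noteq> 0 \<and> x + z \<noteq> 0}
    \<ge> 3 * n - 2" (is "card ?C \<ge> _")
proof (rule ccontr)
  define m where "m = 3 * n - 3"
  assume "\<not> card ?C \<ge> 3 * n - 2"
  then have card_C: "card ?C \<le> m" by (simp add: m_def)
  have "?C \<subseteq> (\<lambda>(x, y, z). x + y + z) ` (S \<times> S \<times> S)" by force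
  then have fin_C: "finite ?C"
    by (rule finite_subset) (simp add: S)
  obtain w where w: "\<And>j. j \<le> n \<Longrightarrow> (\<Sum>s\<in>S. w s * s ^ j) = (if j = n then 1 else 0)"
    using top_coefficient_weights[OF S] by blast
  let ?M = "weighted_moment w S"
  define \<Phi> where "\<Phi> g = (\<Sum>x\<in>S. \<Sum>y\<in>S. \<Sum>z\<in>S.
    w x * w y * w z * ((x + y) * (y + z) * (x + z) * g (x + y + z)))" for g
  have \<Phi>_power: "\<Phi> (\<lambda>t. t ^ j) = ?M 2 1 0 j + ?M 2 0 1 j + ?M 1 2 0 j + ?M 0 2 1 j + ?M 1 0 2 j
      + ?M 0 1 2 j + 2 * ?M 1 1 1 j" for j
    unfolding \<Phi>_def weighted_moment_def sum.distrib[symmetric] sum_distrib_left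
    by (intro sum.cong refl) (simp add: algebra_simps power2_eq_square)
  have \<Phi>_low: "\<Phi> (\<lambda>t. t ^ j) = 0" if "j < m" for j
  proof -
    have "?M a b c j = 0" if "a + b + c = 3" for a b c
      by (rule weighted_moment_below[OF w]) (use that \<open>j < m\<close> in \<open>auto simp: m_def\<close>)
    then show ?thesis by (simp add: \<Phi>_power)
  qed
  define D :: 'a where "D = of_nat (fact (n - 1) * fact (n - 1) * fact n)"
  have \<Phi>_top: "D * \<Phi> (\<lambda>t. t ^ m) = of_nat ((8 * n - 6) * fact m)"
  proof -
    have f: "fact (n - 1) = (n - 1) * (fact (n - 2) :: nat)"
      using fact_reduce[of "n - 1", where 'a = nat] \<open>n \<ge> 2\<close> by (simp add: numeral_2_eq_2)
    have f': "fact n = n * (fact (n - 1) :: nat)"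
      using fact_reduce[of n, where 'a = nat] \<open>n \<ge> 2\<close> by simp
    have D1: "D = of_nat (n - 1) * of_nat (fact (n - 2) * fact (n - 1) * fact n)"
      unfolding D_def of_nat_mult[symmetric] by (subst f) (simp only: mult_ac)
    have D2: "D = of_nat n * of_nat (fact (n - 1) * fact (n - 1) * fact (n - 1))"
      unfolding D_def of_nat_mult[symmetric] by (subst f') (simp only: mult_ac)
    have square: "D * ?M a b c m = of_nat (n - 1) * of_nat (fact m)"
      if "(a, b, c) \<in> {(2,1,0), (2,0,1), (1,2,0), (0,2,1), (1,0,2), (0,1,2)}" for a b c
    proof -
      have "of_nat (fact (n - a) * fact (n - b) * fact (n - c)) * ?M a b c m = of_nat (fact m)"
        by (rule weighted_moment_top[OF w]) (use that \<open>n \<ge> 2\<close> in \<open>auto simp: m_def\<close>)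
      moreover have "fact (n - a) * fact (n - b) * fact (n - c)
          = (fact (n - 2) * fact (n - 1) * fact n :: nat)"
        using that by (auto simp: mult_ac)
      ultimately show ?thesis unfolding D1 by (simp only: mult.assoc)
    qed
    have mixed: "D * ?M 1 1 1 m = of_nat n * of_nat (fact m)"
    proof -
      have "of_nat (fact (n - 1) * fact (n - 1) * fact (n - 1)) * ?M 1 1 1 m = of_nat (fact m)"
        by (rule weighted_moment_top[OF w]) (use \<open>n \<ge> 2\<close> in \<open>auto simp: m_def\<close>)
      then show ?thesis unfolding D2 by (simp only: mult.assoc)
    qed
    have "D * \<Phi> (\<lambda>t. t ^ m) = D * ?M 2 1 0 m + D * ?M 2 0 1 m + D * ?M 1 2 0 m + D * ?M 0 2 1 m
        + D * ?M 1 0 2 m + D * ?M 0 1 2 m + 2 * (D * ?M 1 1 1 m)"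
      unfolding \<Phi>_power by (simp add: algebra_simps)
    also have "\<dots> = 6 * (of_nat (n - 1) * of_nat (fact m)) + 2 * (of_nat n * of_nat (fact m))"
      unfolding mixed by (simp add: square del: of_nat_diff of_nat_fact)
    also have "\<dots> = of_nat ((6 * (n - 1) + 2 * n) * fact m)"
      by (simp only: of_nat_add of_nat_mult of_nat_numeral distrib_right mult.assoc)
    also have "6 * (n - 1) + 2 * n = 8 * n - 6" using \<open>n \<ge> 2\<close> by simp
    finally show ?thesis .
  qed
  \<comment> \<open>Padding with a power of \<open>X\<close> brings the degree up to exactly \<open>m\<close>.\<close>
  define P where "P = (\<Prod>c\<in>?C. [:- c, 1:]) * monom 1 (m - card ?C)"
  have deg_P: "degree P = m"
    unfolding P_def using card_C
    by (subst degree_mult_eq) (auto simp: fin_C degree_prod_eq_sum_degree degree_monom_eq)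
  have "lead_coeff P = 1"
    unfolding P_def lead_coeff_mult lead_coeff_prod by (simp add: degree_monom_eq)
  then have lead_P: "coeff P m = 1" by (simp add: deg_P)
  have "\<Phi> (poly P) = 0"
    unfolding \<Phi>_def
  proof (intro sum.neutral ballI)
    fix x y z assume "x \<in> S" "y \<in> S" "z \<in> S"
    then have "x + y = 0 \<or> y + z = 0 \<or> x + z = 0 \<or> x + y + z \<in> ?C" by blast
    moreover have "poly P c = 0" if "c \<in> ?C" for c
      using that fin_C unfolding P_def poly_mult poly_prod
      by (intro mult_eq_0_iff[THEN iffD2] disjI1 prod_zero) (auto intro!: bexI[of _ c])
    ultimately show "w x * w y * w z * ((x + y) * (y + z) * (x + z) * poly P (x + y + z)) = 0"
      by auto
  qed
  moreover have "\<Phi> (poly P) = \<Phi> (\<lambda>t. t ^ m)"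
  proof -
    have "\<Phi> (poly P) = (\<Sum>x\<in>S. \<Sum>y\<in>S. \<Sum>z\<in>S. \<Sum>j\<le>m.
        coeff P j * (w x * w y * w z * ((x + y) * (y + z) * (x + z) * (x + y + z) ^ j)))"
      unfolding \<Phi>_def poly_altdef deg_P sum_distrib_left
      by (intro sum.cong refl) (simp only: mult_ac)
    also have "\<dots> = (\<Sum>j\<le>m. coeff P j * \<Phi> (\<lambda>t. t ^ j))"
      unfolding \<Phi>_def sum_distrib_left sum.swap[where B = "{..m}"] ..
    also have "\<dots> = (\<Sum>j\<in>{m}. coeff P j * \<Phi> (\<lambda>t. t ^ j))"
      by (rule sum.mono_neutral_right) (auto simp: \<Phi>_low)
    finally show ?thesis by (simp add: lead_P)
  qed
  ultimately have "D * \<Phi> (\<lambda>t. t ^ m) = 0" by simp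
  with \<Phi>_top have "of_nat ((8 * n - 6) * fact m) = (0::'a)" by metis
  with nz show False unfolding m_def by contradiction
qed

section \<open>Signed sumsets\<close>

lemma finite_signed_sumset:
  assumes "finite A"
  shows "finite (signed_sumset h A)"
proof -
  let ?L = "PiE A (\<lambda>_. {- int h..int h})"
  have "signed_sumset h A \<subseteq> (\<lambda>l. \<Sum>a\<in>A. of_int (l a) * a) ` ?L"
  proof
    fix x assume "x \<in> signed_sumset h A"
    then obtain l where l: "x = (\<Sum>a\<in>A. of_int (l a) * a)" "\<forall>a\<in>A. l a \<in> {- int h..int h}"
      unfolding signed_sumset_def by blast
    show "x \<in> (\<lambda>l. \<Sum>a\<in>A. of_int (l a) * a) ` ?L"
    proof (rule image_eqI)
      show "x = (\<Sum>a\<in>A. of_int (restrict l A a) * a)" using l(1) by (simp cong: sum.cong)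
      show "restrict l A \<in> ?L" using l(2) by auto
    qed
  qed
  then show ?thesis
    by (rule finite_subset) (simp add: assms finite_PiE)
qed

text \<open>The coefficient vector of the sum is the sum of the coefficient vectors \<open>e x\<close>, \<open>e y\<close> and
  \<open>e z\<close>, each having a single entry \<open>1\<close> or \<open>-1\<close>.  Entries of different sign never meet, since that
  would make two of the summands opposite; hence absolute values add up to three.\<close>

lemma nonopposite_triple_sum_in_signed_sumset:
  fixes A :: "'a::ring_1 set"
  assumes "finite A" and disj: "A \<inter> uminus ` A = {}"
    and S: "x \<in> A \<union> uminus ` A" "y \<in> A \<union> uminus ` A" "z \<in> A \<union> uminus ` A"
    and ne: "x + y \<noteq> 0" "y + z \<noteq> 0" "x + z \<noteq> 0"
  shows "x + y + z \<in> signed_sumset 3 A"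
proof -
  define e :: "'a \<Rightarrow> 'a \<Rightarrow> int" where
    "e s a = (if s = a then 1 else if s = - a then - 1 else 0)" for s a
  have single: "(\<Sum>a\<in>A. of_int (e s a) * a) = s \<and> (\<Sum>a\<in>A. \<bar>e s a\<bar>) = 1"
    if "s \<in> A \<union> uminus ` A" for s
  proof -
    from that obtain b where b: "b \<in> A" "s = b \<or> s = - b" by auto
    have opp: "a \<noteq> - a'" if "a \<in> A" "a' \<in> A" for a a' using disj that by auto
    have other: "e s a = 0" if "a \<in> A - {b}" for a
      using that b opp[of a b] opp[of b a] by (auto simp: e_def)
    have "(\<Sum>a\<in>A. of_int (e s a) * a) = of_int (e s b) * b"
      using assms(1) b(1) other by (subst sum.remove[of A b]) auto
    moreover have "(\<Sum>a\<in>A. \<bar>e s a\<bar>) = \<bar>e s b\<bar>"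
      using assms(1) b(1) other by (subst sum.remove[of A b]) auto
    ultimately show ?thesis using b(2) opp[OF b(1) b(1)] by (auto simp: e_def)
  qed
  define l where "l a = e x a + e y a + e z a" for a
  have "x + y + z = (\<Sum>a\<in>A. of_int (l a) * a)"
    using S[THEN single] by (simp add: l_def distrib_right sum.distrib)
  moreover have "\<forall>a\<in>A. l a \<in> {- int 3..int 3}"
    by (auto simp: l_def e_def)
  moreover have "(\<Sum>a\<in>A. \<bar>l a\<bar>) = int 3"
  proof -
    have "\<bar>l a\<bar> = \<bar>e x a\<bar> + \<bar>e y a\<bar> + \<bar>e z a\<bar>" for a
      using ne by (auto simp: l_def e_def)
    then show ?thesis using S[THEN single] by (simp add: sum.distrib)
  qed
  ultimately show ?thesis unfolding signed_sumset_def by blast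
qed

theorem theorem3p7:
  fixes k :: nat and A :: "'a::field set"
  assumes "k \<ge> 2"
    and "smallest_subgroup_order TYPE('a) > enat (6 * k - 6)"
    and "smallest_subgroup_order TYPE('a) \<noteq> enat (8 * k - 7)"
    and "finite A" and "card A = k"
    and "A \<inter> uminus ` A = {}"
  shows "card (signed_sumset 3 A) \<ge> 6 * k - 5"
proof -
  define n where "n = 2 * k - 1"
  have n: "8 * n - 6 = 2 * (8 * k - 7)" "3 * n - 3 = 6 * k - 6" "3 * n - 2 = 6 * k - 5" "n \<ge> 2"
    using \<open>k \<ge> 2\<close> by (auto simp: n_def)
  let ?S = "A \<union> uminus ` A"
  have "card (uminus ` A) = k" using \<open>card A = k\<close> by (simp add: card_image)
  then have card_S: "card ?S = Suc n"
    using assms by (simp add: card_Un_disjoint n_def)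
  note small = of_nat_neq_0_if_less_smallest_subgroup_order[OF assms(2)]
  have "of_nat (8 * k - 7) \<noteq> (0::'a)"
  proof
    assume eq0: "of_nat (8 * k - 7) = (0::'a)"
    then have dvd: "CHAR('a) dvd 8 * k - 7"
      by (simp only: of_nat_eq_0_iff_char_dvd)
    then obtain q where q: "8 * k - 7 = CHAR('a) * q" by (rule dvdE)
    with \<open>k \<ge> 2\<close> have pos: "CHAR('a) > 0" "q > 0" by (auto intro: gr0I)
    then have p: "smallest_subgroup_order TYPE('a) = enat CHAR('a)"
      by (simp add: smallest_subgroup_order_eq_CHAR)
    with assms(2) have "CHAR('a) > 6 * k - 6" by simp
    then have "CHAR('a) * 2 > 8 * k - 7" using \<open>k \<ge> 2\<close> by linarith
    with q have "CHAR('a) * q < CHAR('a) * 2" by simp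
    with pos have "q = 1" by simp
    with q p assms(3) show False by simp
  qed
  moreover have "of_nat 2 \<noteq> (0::'a)" using \<open>k \<ge> 2\<close> by (intro small) auto
  moreover have "of_nat (fact (6 * k - 6)) \<noteq> (0::'a)" by (intro of_nat_fact_neq_0 small)
  ultimately have "of_nat ((8 * n - 6) * fact (3 * n - 3)) \<noteq> (0::'a)"
    unfolding n of_nat_mult by (simp only: mult_eq_0_iff not_False_eq_True simp_thms)
  then have "6 * k - 5 \<le> card {x + y + z | x y z.
      x \<in> ?S \<and> y \<in> ?S \<and> z \<in> ?S \<and> x + y \<noteq> 0 \<and> y + z \<noteq> 0 \<and> x + z \<noteq> 0}"
    using card_nonopposite_triple_sums[of ?S n] card_S n \<open>finite A\<close> by simp
  also have "\<dots> \<le> card (signed_sumset 3 A)"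
    using assms(4,6)
    by (intro card_mono finite_signed_sumset)
      (auto intro!: nonopposite_triple_sum_in_signed_sumset)
  finally show ?thesis .
qed

end
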